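(* Let $1\le m<n$, $N=2^n$, $K=2^{n-m}$, let $a_0,\ldots,a_{N-1}\ge 0$ be data points with $A=\sum_{j=0}^{N-1}a_j>0$, and put $p_j=a_j/A$. Let $\mathcal{K}\subset\{0,\ldots,N-1\}$ be the set of the $K$ integers $j=(j_{n-1},\ldots,j_0)$ with $(j_{m-1},\ldots,j_0)=\mathbf{1}_m$ (all ones). For a permutation $\pi\in\mathcal{S}_N$, consider the state $\sum_{j=0}^{N-1}\sqrt{p_{\pi(j)}}\,|j\rangle_N\otimes|0\rangle_2$, apply the $(m+1)$-qubit Toffoli gate whose controls are the $m$ qubits carrying the bits $j_{m-1},\ldots,j_0$ and whose target is the extra qubit, and measure the extra qubit in the computational basis. Then: (i) the outcome is $|1\rangle_2$ with probability $p=\sum_{k\in\mathcal{K}}p_{\pi(k)}$ and $|0\rangle_2$ with probability $q=1-p=\sum_{k\notin\mathcal{K}}p_{\pi(k)}$; (ii) the mean of the sample $\{a_{\pi(k)}:k\in\mathcal{K}\}$ of size $K$ equals $p\cdot\frac{A}{K}$; (iii) the relation $\{\pi(j):j\in\mathcal{K}\}=\{\tau(j):j\in\mathcal{K}\}$ on pairs $\pi,\tau$ partitions $\mathcal{S}_N$ into $\binom{N}{K}$ classes, each containing $K!\,(N-K)!$ permutations, and $p$ depends only on the class of $\pi$.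
   Context: $\mathcal{S}_N$ is the group of permutations of $\{0,\ldots,N-1\}$. $|j\rangle_N$, $0\le j\le N-1$, is the canonical basis of the $n$-qubit space $\mathbb{C}^{N}$, with $j=\sum_{l=0}^{n-1}j_l2^l$, $j_l\in\{0,1\}$; $|0\rangle_2,|1\rangle_2$ is the canonical basis of the extra qubit. The $(m+1)$-qubit Toffoli gate flips the target qubit if and only if all $m$ control qubits are in state $|1\rangle$. Means of samples are taken with multiplicity over the index set, i.e. the mean in (ii) is $\frac1K\sum_{k\in\mathcal{K}}a_{\pi(k)}$. *)

theory Defs
  imports
    "HOL-Combinatorics.Permutations"
    "Jordan_Normal_Form.Matrix"
begin

(* Kronecker conventions: a basis state |i> \<otimes> |b> of C^d \<otimes> C^e is the unit vector with
   index i * e + b.  For e = 2 the second factor is therefore bit 0 of the joint index,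
   and bit l of i is bit (Suc l) of the joint index. *)

definition tensor_vec :: "complex vec \<Rightarrow> complex vec \<Rightarrow> complex vec" where
  "tensor_vec u v = vec (dim_vec u * dim_vec v)
     (\<lambda>i. u $ (i div dim_vec v) * v $ (i mod dim_vec v))"

definition tensor_mat :: "complex mat \<Rightarrow> complex mat \<Rightarrow> complex mat" where
  "tensor_mat A B = mat (dim_row A * dim_row B) (dim_col A * dim_col B)
     (\<lambda>(r, c). A $$ (r div dim_row B, c div dim_col B) * B $$ (r mod dim_row B, c mod dim_col B))"

definition ket_bra :: "complex vec \<Rightarrow> complex mat" where
  "ket_bra v = mat (dim_vec v) (dim_vec v) (\<lambda>(r, c). v $ r * cnj (v $ c))"

(* The Toffoli gate on the control qubits C and the target qubit t of a q-qubit register,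
   extended by the identity on all other qubits. *)
definition toffoli :: "nat \<Rightarrow> nat set \<Rightarrow> nat \<Rightarrow> complex mat" where
  "toffoli q C t = mat (2 ^ q) (2 ^ q)
     (\<lambda>(r, c). if r = (if \<forall>l\<in>C. bit c l then flip_bit t c else c) then 1 else 0)"

(* Born rule for measuring the qubit factor of a state in C^d \<otimes> C^2:
   the squared norm of (1 \<otimes> |b><b|) psi. *)
definition measure_last_qubit :: "nat \<Rightarrow> complex vec \<Rightarrow> nat \<Rightarrow> real" where
  "measure_last_qubit d \<psi> b =
     (let \<phi> = tensor_mat (1\<^sub>m d) (ket_bra (unit_vec 2 b)) *\<^sub>v \<psi> in Re (\<phi> \<bullet>c \<phi>))"

definition input_state :: "nat \<Rightarrow> (nat \<Rightarrow> real) \<Rightarrow> (nat \<Rightarrow> nat) \<Rightarrow> complex vec" where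
  "input_state n p \<pi> = finsum_vec TYPE(complex) (2 ^ n * 2)
     (\<lambda>j. complex_of_real (sqrt (p (\<pi> j))) \<cdot>\<^sub>v tensor_vec (unit_vec (2 ^ n) j) (unit_vec 2 0))
     {..<2 ^ n}"

(* Controls: bits 0..<m of the n-qubit register, that is bits 1..m of the joint index. *)
definition outcome_prob :: "nat \<Rightarrow> nat \<Rightarrow> (nat \<Rightarrow> real) \<Rightarrow> (nat \<Rightarrow> nat) \<Rightarrow> nat \<Rightarrow> real" where
  "outcome_prob n m p \<pi> b =
     measure_last_qubit (2 ^ n) (toffoli (Suc n) (Suc ` {..<m}) 0 *\<^sub>v input_state n p \<pi>) b"

definition all_ones_indices :: "nat \<Rightarrow> nat \<Rightarrow> nat set" where
  "all_ones_indices n m = {j. j < 2 ^ n \<and> (\<forall>l<m. bit j l)}"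

definition sym_perms :: "nat \<Rightarrow> (nat \<Rightarrow> nat) set" where
  "sym_perms N = {\<pi>. \<pi> permutes {..<N}}"

definition same_image_rel :: "nat \<Rightarrow> nat set \<Rightarrow> ((nat \<Rightarrow> nat) \<times> (nat \<Rightarrow> nat)) set" where
  "same_image_rel N S = {(\<pi>, \<tau>). \<pi> \<in> sym_perms N \<and> \<tau> \<in> sym_perms N \<and> \<pi> ` S = \<tau> ` S}"

end

theory Submission
  imports Defs
begin

(* The Toffoli gate is a permutation matrix that moves the amplitude of |k>|0> to |k>|1> exactly for
   k in the all-ones index set, so Born's rule returns the sum of the p (\<pi> k) over that set.
   Since S_N acts transitively on K-subsets and composition with a representative carries the
   stabiliser of the set onto each class, the classes correspond to the K-subsets and all have the
   same size, which N! = K! (N-K)! (N choose K) then determines. *)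

section \<open>Projective measurement and the input state in coordinates\<close>

text \<open>The projector is diagonal and keeps exactly the entries whose index has remainder
  \<open>b\<close> modulo 2, so its output has one surviving entry per basis state of the first
  factor.\<close>

lemma measure_last_qubit_eq:
  assumes "dim_vec \<psi> = d * 2" and "b < 2"
  shows "measure_last_qubit d \<psi> b = (\<Sum>i<d. (cmod (\<psi> $ (2 * i + b)))\<^sup>2)"
proof -
  define \<phi> where "\<phi> = tensor_mat (1\<^sub>m d) (ket_bra (unit_vec 2 b)) *\<^sub>v \<psi>"
  have dim: "dim_vec \<phi> = d * 2"
    by (simp add: \<phi>_def tensor_mat_def ket_bra_def)
  have entry: "\<phi> $ r = (if r mod 2 = b then \<psi> $ r else 0)" if r: "r < d * 2" for r
  proof -
    have "\<phi> $ r = (\<Sum>c<d * 2. tensor_mat (1\<^sub>m d) (ket_bra (unit_vec 2 b)) $$ (r, c) * \<psi> $ c)"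
      using r assms
      by (simp add: \<phi>_def tensor_mat_def ket_bra_def scalar_prod_def lessThan_atLeast0)
    also have "\<dots> = (\<Sum>c<d * 2. if c = r then (if r mod 2 = b then \<psi> $ r else 0) else 0)"
    proof (rule sum.cong[OF refl])
      fix c assume "c \<in> {..<d * 2}"
      then have c: "c < d * 2" by simp
      have div: "r div 2 < d" "c div 2 < d" using r c by auto
      \<comment> \<open>The matrix entry is a delta on the quotients times a delta on the
        remainders; the two together force \<open>c = r\<close>.\<close>
      have eq: "c = r \<longleftrightarrow> c div 2 = r div 2 \<and> c mod 2 = r mod 2"
        by (metis div_mult_mod_eq)
      show "tensor_mat (1\<^sub>m d) (ket_bra (unit_vec 2 b)) $$ (r, c) * \<psi> $ c =
        (if c = r then (if r mod 2 = b then \<psi> $ r else 0) else 0)"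
        using r c div assms(2) eq by (auto simp: tensor_mat_def ket_bra_def)
    qed
    also have "\<dots> = (if r mod 2 = b then \<psi> $ r else 0)"
      using r by simp
    finally show ?thesis .
  qed
  have "measure_last_qubit d \<psi> b = (\<Sum>r<d * 2. (cmod (\<phi> $ r))\<^sup>2)"
    unfolding measure_last_qubit_def Let_def \<phi>_def[symmetric]
    by (simp add: scalar_prod_def dim lessThan_atLeast0 complex_mult_cnj cmod_power2)
  \<comment> \<open>The joint indices are grouped into pairs \<open>2 * i\<close>,
    \<open>2 * i + 1\<close>, of which the projector leaves one.\<close>
  also have "\<dots> = (\<Sum>i<d. \<Sum>r\<in>{i * 2..<i * 2 + 2}. (cmod (\<phi> $ r))\<^sup>2)"
    by (rule sum.nat_group[symmetric])
  also have "\<dots> = (\<Sum>i<d. (cmod (\<psi> $ (2 * i + b)))\<^sup>2)"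
  proof (rule sum.cong[OF refl])
    fix i assume "i \<in> {..<d}"
    then have i: "i * 2 < d * 2" "Suc (i * 2) < d * 2" by auto
    have "{i * 2..<i * 2 + 2} = {i * 2, Suc (i * 2)}" by auto
    moreover have "b = 0 \<or> b = 1" using assms(2) by auto
    ultimately show "(\<Sum>r\<in>{i * 2..<i * 2 + 2}. (cmod (\<phi> $ r))\<^sup>2) = (cmod (\<psi> $ (2 * i + b)))\<^sup>2"
      using entry[OF i(1)] entry[OF i(2)] by (auto simp: mult.commute mod_Suc)
  qed
  finally show ?thesis .
qed

lemma input_state_summand_carrier:
  "(\<lambda>j. c j \<cdot>\<^sub>v tensor_vec (unit_vec d (f j)) (unit_vec e b)) \<in> J \<rightarrow> carrier_vec (d * e)"
  by (intro Pi_I carrier_vecI) (simp add: tensor_vec_def)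

lemma dim_input_state: "dim_vec (input_state n p \<pi>) = 2 ^ n * 2"
  unfolding input_state_def
  by (rule carrier_vecD, rule finsum_vec_closed, rule input_state_summand_carrier)

lemma index_input_state:
  assumes "r < 2 ^ n * 2"
  shows "input_state n p \<pi> $ r = (if even r then complex_of_real (sqrt (p (\<pi> (r div 2)))) else 0)"
proof -
  have "input_state n p \<pi> $ r =
    (\<Sum>j<2 ^ n. (complex_of_real (sqrt (p (\<pi> j))) \<cdot>\<^sub>v
      tensor_vec (unit_vec (2 ^ n) j) (unit_vec 2 0)) $ r)"
    unfolding input_state_def using assms
    by (intro index_finsum_vec input_state_summand_carrier) auto
  \<comment> \<open>Summand \<open>j\<close> is supported at the joint index \<open>2 * j\<close>
    alone, because the extra qubit starts in state 0.\<close>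
  also have "\<dots> = (\<Sum>j<2 ^ n. if j = r div 2
      then (if even r then complex_of_real (sqrt (p (\<pi> (r div 2)))) else 0) else 0)"
    using assms by (intro sum.cong) (auto simp: tensor_vec_def even_iff_mod_2_eq_zero)
  also have "\<dots> = (if even r then complex_of_real (sqrt (p (\<pi> (r div 2)))) else 0)"
    using assms by (simp add: less_mult_imp_div_less)
  finally show ?thesis .
qed

section \<open>The Toffoli gate and the outcome probabilities\<close>

lemma flip_bit_0_double:
  fixes i :: nat
  assumes "b < 2"
  shows "flip_bit 0 (2 * i + b) = 2 * i + (1 - b)"
  using assms by (cases b) (auto simp: flip_bit_0)

text \<open>On the joint index the gate is an involution, so a row of its matrix
  has its unique 1 in the column that the gate sends that row to.\<close>

lemma index_toffoli_mult:
  assumes "\<psi> \<in> carrier_vec (2 ^ Suc n)" and "i < 2 ^ n" and "b < 2"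
  shows "(toffoli (Suc n) (Suc ` C) 0 *\<^sub>v \<psi>) $ (2 * i + b) =
    \<psi> $ (2 * i + (if \<forall>l\<in>C. bit i l then 1 - b else b))"
proof -
  define \<sigma> where "\<sigma> c = (if \<forall>l\<in>Suc ` C. bit c l then flip_bit 0 c else c)" for c :: nat
  define s where "s = 2 * i + (if \<forall>l\<in>C. bit i l then 1 - b else b)"
  \<comment> \<open>The controls start at bit 1 of the joint index, so they read the bits of
    \<open>j\<close> and never the target bit \<open>e\<close>.\<close>
  have \<sigma>: "\<sigma> (2 * j + e) = 2 * j + (if \<forall>l\<in>C. bit j l then 1 - e else e)" if "e < 2" for j e
  proof -
    have "bit (2 * j + e) (Suc l) = bit j l" for l
      using that by (simp add: bit_Suc)
    then show ?thesis
      using flip_bit_0_double[OF that] by (simp add: \<sigma>_def)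
  qed
  have digits: "2 * j + e = 2 * k + f \<longleftrightarrow> j = k \<and> e = f" if "e < 2" "f < 2" for j k e f :: nat
    using that by presburger
  \<comment> \<open>The gate keeps the quotient by 2, so both sides fail when the quotients differ;
    when they agree, \<open>1 - e\<close> is self-inverse on 0 and 1.\<close>
  have row: "2 * i + b = \<sigma> c \<longleftrightarrow> c = s" for c
  proof -
    have c: "c = 2 * (c div 2) + c mod 2" "c mod 2 < 2" by auto
    have "2 * i + b = \<sigma> (2 * j + e) \<longleftrightarrow> 2 * j + e = s" if "e < 2" for j e
    proof (cases "i = j")
      case True
      then show ?thesis
        using that assms(3) unfolding \<sigma>[OF that] s_def by (cases "\<forall>l\<in>C. bit j l") auto
    next
      case False
      then show ?thesis
        using that assms(3) digits[of _ _ i j] digits[of _ _ j i] unfolding \<sigma>[OF that] s_def by auto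
    qed
    from this[OF c(2), of "c div 2"] show ?thesis by simp
  qed
  have s: "s < 2 ^ Suc n"
    using assms(2,3) by (auto simp: s_def)
  have "(toffoli (Suc n) (Suc ` C) 0 *\<^sub>v \<psi>) $ (2 * i + b) =
    (\<Sum>c<2 ^ Suc n. (if 2 * i + b = \<sigma> c then 1 else 0) * \<psi> $ c)"
    using assms by (simp add: toffoli_def scalar_prod_def lessThan_atLeast0 \<sigma>_def)
  also have "\<dots> = (\<Sum>c<2 ^ Suc n. if c = s then \<psi> $ c else 0)"
    by (intro sum.cong) (auto simp: row)
  also have "\<dots> = \<psi> $ s"
    using s by simp
  finally show ?thesis unfolding s_def .
qed

text \<open>Outcome \<open>b\<close> reads position \<open>2 * i + b\<close> after the gate. Traced
  back through the gate, this is the occupied position \<open>2 * i\<close> for outcome 1 when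
  \<open>i\<close> is all ones, for outcome 0 otherwise; every other case hits amplitude 0.\<close>

lemma outcome_prob_eq:
  assumes nonneg: "\<And>i. i < 2 ^ n \<Longrightarrow> p (\<pi> i) \<ge> 0"
  shows "outcome_prob n m p \<pi> 1 = (\<Sum>k\<in>all_ones_indices n m. p (\<pi> k))"
    and "outcome_prob n m p \<pi> 0 = (\<Sum>k\<in>{..<2 ^ n} - all_ones_indices n m. p (\<pi> k))"
proof -
  let ?\<psi> = "input_state n p \<pi>"
  have car: "?\<psi> \<in> carrier_vec (2 ^ Suc n)"
    by (intro carrier_vecI) (simp add: dim_input_state)
  have prob: "outcome_prob n m p \<pi> b =
    (\<Sum>i<2 ^ n. (cmod (?\<psi> $ (2 * i + (if \<forall>l\<in>{..<m}. bit i l then 1 - b else b))))\<^sup>2)"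
    if "b < 2" for b
    unfolding outcome_prob_def using that car
    by (subst measure_last_qubit_eq) (auto simp: toffoli_def[of "Suc n"] index_toffoli_mult[symmetric])
  \<comment> \<open>Nonnegativity is what lets the squared modulus undo the square root.\<close>
  have amp: "(cmod (?\<psi> $ (2 * i)))\<^sup>2 = p (\<pi> i)" "?\<psi> $ (Suc (2 * i)) = 0" if "i < 2 ^ n" for i
    using that nonneg by (simp_all add: index_input_state)
  have "outcome_prob n m p \<pi> 1 = (\<Sum>i<2 ^ n. if \<forall>l<m. bit i l then p (\<pi> i) else 0)"
    by (subst prob) (auto simp: amp intro!: sum.cong)
  also have "\<dots> = (\<Sum>k\<in>all_ones_indices n m. p (\<pi> k))"
    by (intro sum.mono_neutral_cong_right) (auto simp: all_ones_indices_def)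
  finally show "outcome_prob n m p \<pi> 1 = (\<Sum>k\<in>all_ones_indices n m. p (\<pi> k))" .
  have "outcome_prob n m p \<pi> 0 = (\<Sum>i<2 ^ n. if \<forall>l<m. bit i l then 0 else p (\<pi> i))"
    by (subst prob) (auto simp: amp intro!: sum.cong)
  also have "\<dots> = (\<Sum>k\<in>{..<2 ^ n} - all_ones_indices n m. p (\<pi> k))"
    by (intro sum.mono_neutral_cong_right) (auto simp: all_ones_indices_def)
  finally show "outcome_prob n m p \<pi> 0 = (\<Sum>k\<in>{..<2 ^ n} - all_ones_indices n m. p (\<pi> k))" .
qed

section \<open>Size of the all-ones index set\<close>

text \<open>The low \<open>m\<close> bits are prescribed, namely those of \<open>mask m\<close>, and
  the remaining \<open>n - m\<close> bits form a free quotient.\<close>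

lemma card_all_ones_indices:
  assumes "m \<le> n"
  shows "card (all_ones_indices n m) = 2 ^ (n - m)"
proof -
  have pow: "(2::nat) ^ n = 2 ^ (n - m) * 2 ^ m"
    using assms by (simp flip: power_add)
  have ones: "(\<forall>l<m. bit j l) \<longleftrightarrow> j mod 2 ^ m = mask m" for j :: nat
    by (auto simp: bit_eq_iff bit_mask_iff bit_take_bit_iff simp flip: take_bit_eq_mod)
  have mask: "mask m < (2::nat) ^ m"
    by (simp add: mask_eq_exp_minus_1)
  have "all_ones_indices n m = (\<lambda>i. i * 2 ^ m + mask m) ` {..<2 ^ (n - m)}"
  proof (intro equalityI subsetI)
    fix j assume "j \<in> all_ones_indices n m"
    then have "j < 2 ^ (n - m) * 2 ^ m" "j mod 2 ^ m = mask m"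
      by (auto simp: all_ones_indices_def ones pow)
    then show "j \<in> (\<lambda>i. i * 2 ^ m + mask m) ` {..<2 ^ (n - m)}"
      by (intro image_eqI[of _ _ "j div 2 ^ m"])
        (auto simp: less_mult_imp_div_less div_mult_mod_eq simp flip: \<open>j mod 2 ^ m = mask m\<close>)
  next
    fix j :: nat assume "j \<in> (\<lambda>i. i * 2 ^ m + mask m) ` {..<2 ^ (n - m)}"
    then obtain i where i: "i < 2 ^ (n - m)" and j: "j = i * 2 ^ m + mask m" by auto
    \<comment> \<open>Adding the mask to \<open>i * 2 ^ m\<close> stays within block
      \<open>i\<close>, whose upper end is at most \<open>2 ^ n\<close>.\<close>
    have "j < Suc i * 2 ^ m" using mask j by simp
    also have "\<dots> \<le> 2 ^ (n - m) * 2 ^ m" using i by (intro mult_right_mono) auto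
    finally show "j \<in> all_ones_indices n m"
      using mask j by (simp add: all_ones_indices_def ones pow)
  qed
  then show ?thesis
    by (simp add: card_image inj_on_def)
qed

section \<open>Permutations grouped by the image of a fixed set\<close>

lemma equiv_same_image_rel: "equiv (sym_perms N) (same_image_rel N S)"
  by (intro equivI) (auto simp: same_image_rel_def refl_on_def sym_def trans_def)

text \<open>Complements of equinumerous subsets of a finite set are equinumerous, so a bijection of
  the sets can be glued to one of the complements.\<close>

lemma exists_permutes_image:
  assumes "finite V" and "S \<subseteq> V" and "T \<subseteq> V" and "card S = card T"
  shows "\<exists>\<pi>. \<pi> permutes V \<and> \<pi> ` S = T"
proof -
  have fin: "finite S" "finite T" using assms finite_subset by auto
  obtain f where f: "bij_betw f S T"
    using finite_same_card_bij[OF fin assms(4)] by blast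
  have "card (V - S) = card (V - T)"
    using assms fin by (simp add: card_Diff_subset)
  then obtain g where g: "bij_betw g (V - S) (V - T)"
    using finite_same_card_bij assms(1) by blast
  \<comment> \<open>The last branch fixes all points outside \<open>V\<close>, as
    \<open>permutes\<close> demands.\<close>
  define h where "h x = (if x \<in> S then f x else if x \<in> V then g x else x)" for x
  have hS: "bij_betw h S T"
    using f by (rule bij_betw_cong[THEN iffD1, rotated]) (simp add: h_def)
  have hVS: "bij_betw h (V - S) (V - T)"
    using g by (rule bij_betw_cong[THEN iffD1, rotated]) (simp add: h_def)
  have "bij_betw h (S \<union> (V - S)) (T \<union> (V - T))"
    using hS hVS by (rule bij_betw_combine) auto
  then have "bij_betw h V V"
    using assms(2,3) by (simp add: Un_absorb1)
  then have "h permutes V"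
    using assms(2) by (intro bij_imp_permutes) (auto simp: h_def)
  then show ?thesis
    using hS by (auto simp: bij_betw_def)
qed

lemma same_image_rel_Image:
  assumes "\<pi> \<in> sym_perms N"
  shows "same_image_rel N S `` {\<pi>} = {\<tau> \<in> sym_perms N. \<tau> ` S = \<pi> ` S}"
  using assms by (auto simp: same_image_rel_def)

text \<open>The classes are the nonempty fibres of the map sending a permutation to its image of
  \<open>S\<close>, so it suffices to count the attained images.\<close>

lemma card_quotient_same_image_rel:
  assumes "S \<subseteq> {..<N}"
  shows "card (sym_perms N // same_image_rel N S) = N choose card S"
proof -
  let ?I = "\<lambda>\<pi>::nat \<Rightarrow> nat. \<pi> ` S"
  let ?c = "\<lambda>T. {\<tau> \<in> sym_perms N. \<tau> ` S = T}"
  have img: "?I ` sym_perms N = {T. T \<subseteq> {..<N} \<and> card T = card S}"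
  proof (intro equalityI subsetI)
    fix T assume "T \<in> ?I ` sym_perms N"
    then obtain \<pi> where "\<pi> permutes {..<N}" "T = \<pi> ` S" by (auto simp: sym_perms_def)
    then show "T \<in> {T. T \<subseteq> {..<N} \<and> card T = card S}"
      using assms permutes_image image_mono
      by (fastforce intro: card_image permutes_inj_on)
  next
    fix T assume "T \<in> {T. T \<subseteq> {..<N} \<and> card T = card S}"
    then show "T \<in> ?I ` sym_perms N"
      using exists_permutes_image[OF finite_lessThan assms, of T] by (auto simp: sym_perms_def)
  qed
  have "sym_perms N // same_image_rel N S = ?c ` ?I ` sym_perms N"
    by (auto simp: quotient_def same_image_rel_Image)
  \<comment> \<open>Fibres over attained images are nonempty; a common member of two equal fibres
    identifies their images.\<close>
  moreover have "inj_on ?c (?I ` sym_perms N)"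
    by (intro inj_onI) blast
  ultimately show ?thesis
    by (simp add: card_image img n_subsets)
qed

text \<open>Each class is a left coset of the stabiliser of \<open>S\<close>, and left composition
  with a permutation is injective.\<close>

lemma card_same_image_class:
  assumes "X \<in> sym_perms N // same_image_rel N S"
  shows "card X = card {\<sigma> \<in> sym_perms N. \<sigma> ` S = S}"
proof -
  obtain \<pi> where \<pi>: "\<pi> permutes {..<N}" and X: "X = {\<tau> \<in> sym_perms N. \<tau> ` S = \<pi> ` S}"
    using assms by (auto simp: quotient_def same_image_rel_Image) (auto simp: sym_perms_def)
  have "X = (\<circ>) \<pi> ` {\<sigma> \<in> sym_perms N. \<sigma> ` S = S}"
  proof (intro equalityI subsetI)
    fix \<tau> assume \<tau>: "\<tau> \<in> X"
    \<comment> \<open>The stabiliser element is the inverse of \<open>\<pi>\<close> after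
      \<open>\<tau>\<close>: since \<open>\<tau>\<close> and \<open>\<pi>\<close> agree on the image
      of \<open>S\<close>, it carries \<open>S\<close> back to itself.\<close>
    have "\<tau> = \<pi> \<circ> (inv_into UNIV \<pi> \<circ> \<tau>)"
      using permutes_inv_o(1)[OF \<pi>] by (simp add: comp_assoc[symmetric])
    moreover have "(inv_into UNIV \<pi> \<circ> \<tau>) ` S = S"
      using \<tau> permutes_inv_o(2)[OF \<pi>] by (simp only: X mem_Collect_eq image_comp[symmetric]) (simp add: image_comp)
    moreover have "inv_into UNIV \<pi> \<circ> \<tau> \<in> sym_perms N"
      using \<tau> \<pi> by (auto simp: X sym_perms_def intro: permutes_compose permutes_inv)
    ultimately show "\<tau> \<in> (\<circ>) \<pi> ` {\<sigma> \<in> sym_perms N. \<sigma> ` S = S}" by blast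
  next
    fix \<tau> assume "\<tau> \<in> (\<circ>) \<pi> ` {\<sigma> \<in> sym_perms N. \<sigma> ` S = S}"
    then obtain \<sigma> where \<sigma>: "\<tau> = \<pi> \<circ> \<sigma>" "\<sigma> permutes {..<N}" "\<sigma> ` S = S"
      by (auto simp: sym_perms_def)
    have "\<tau> ` S = \<pi> ` S"
      unfolding \<sigma>(1) image_comp[symmetric] \<sigma>(3) ..
    then show "\<tau> \<in> X"
      using permutes_compose[OF \<sigma>(2) \<pi>] by (simp add: X sym_perms_def \<sigma>(1))
  qed
  moreover have "inj_on ((\<circ>) \<pi>) {\<sigma> \<in> sym_perms N. \<sigma> ` S = S}"
    using permutes_inj[OF \<pi>] by (intro inj_onI) (simp add: fun.inj_map_strong inj_eq fun_eq_iff)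
  ultimately show ?thesis
    by (simp add: card_image)
qed

text \<open>The stabiliser is never counted directly: the equal-sized classes partition the
  \<open>N!\<close> permutations, and their number is already known.\<close>

lemma card_same_image_class_eq_fact:
  assumes "S \<subseteq> {..<N}" and X: "X \<in> sym_perms N // same_image_rel N S"
  shows "card X = fact (card S) * fact (N - card S)"
proof -
  let ?Q = "sym_perms N // same_image_rel N S"
  let ?s = "card {\<sigma> \<in> sym_perms N. \<sigma> ` S = S}"
  have fin: "finite (sym_perms N)"
    by (simp add: sym_perms_def finite_permutations)
  have le: "card S \<le> N"
    using card_mono[OF finite_lessThan assms(1)] by simp
  have "fact N = card (sym_perms N)"
    by (simp add: sym_perms_def card_permutations)
  also have "\<dots> = card (\<Union>?Q)"
    by (simp add: Union_quotient[OF equiv_same_image_rel])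
  also have "\<dots> = (\<Sum>Y\<in>?Q. card Y)"
  proof (rule card_Union_disjoint)
    show "pairwise disjnt ?Q"
      using quotient_disj[OF equiv_same_image_rel] unfolding pairwise_def disjnt_def by blast
    show "finite Y" if "Y \<in> ?Q" for Y
      using in_quotient_imp_subset[OF equiv_same_image_rel that] fin by (rule finite_subset)
  qed
  also have "\<dots> = (\<Sum>Y\<in>?Q. ?s)"
    by (intro sum.cong refl card_same_image_class)
  also have "\<dots> = (N choose card S) * ?s"
    by (simp add: card_quotient_same_image_rel[OF assms(1)])
  finally have "(N choose card S) * ?s = fact N" ..
  also have "\<dots> = (N choose card S) * (fact (card S) * fact (N - card S))"
    using binomial_fact_lemma[OF le] by (simp only: ac_simps)
  \<comment> \<open>The binomial coefficient cancels because \<open>card S \<le> N\<close> makes it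
    nonzero.\<close>
  finally have "?s = fact (card S) * fact (N - card S)"
    by (rule mult_left_cancel[THEN iffD1, rotated]) (use le in \<open>simp add: not_less\<close>)
  then show ?thesis
    using card_same_image_class[OF X] by simp
qed

section \<open>Normalisation, sample mean and dependence on the class alone\<close>

theorem mainTheorem8:
  fixes m n N K :: nat and a p :: "nat \<Rightarrow> real" and A :: real and \<K> :: "nat set"
  assumes "1 \<le> m" and "m < n"
    and "N = 2 ^ n" and "K = 2 ^ (n - m)"
    and "\<And>j. j < N \<Longrightarrow> a j \<ge> 0"
    and "A = (\<Sum>j<N. a j)" and "A > 0"
    and "\<And>j. j < N \<Longrightarrow> p j = a j / A"
    and "\<K> = all_ones_indices n m"
  shows
    "(\<forall>\<pi>\<in>sym_perms N.
        outcome_prob n m p \<pi> 1 = (\<Sum>k\<in>\<K>. p (\<pi> k)) \<and>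
        outcome_prob n m p \<pi> 0 = 1 - outcome_prob n m p \<pi> 1 \<and>
        outcome_prob n m p \<pi> 0 = (\<Sum>k\<in>{..<N} - \<K>. p (\<pi> k))) \<and>
     card \<K> = K \<and>
     (\<forall>\<pi>\<in>sym_perms N.
        (\<Sum>k\<in>\<K>. a (\<pi> k)) / real K = outcome_prob n m p \<pi> 1 * (A / real K)) \<and>
     equiv (sym_perms N) (same_image_rel N \<K>) \<and>
     card (sym_perms N // same_image_rel N \<K>) = N choose K \<and>
     (\<forall>X\<in>sym_perms N // same_image_rel N \<K>. card X = fact K * fact (N - K)) \<and>
     (\<forall>(\<pi>, \<tau>)\<in>same_image_rel N \<K>. outcome_prob n m p \<pi> 1 = outcome_prob n m p \<tau> 1)"
proof -
  have nonneg: "p (\<pi> i) \<ge> 0" if "\<pi> \<in> sym_perms N" "i < 2 ^ n" for \<pi> i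
  proof -
    have "\<pi> i < N"
      using that permutes_in_image[of \<pi> "{..<N}" i] assms(3) by (simp add: sym_perms_def)
    then show ?thesis using assms(5,7,8) by simp
  qed
  have sub: "\<K> \<subseteq> {..<N}"
    using assms(3,9) by (auto simp: all_ones_indices_def)
  have card: "card \<K> = K"
    using assms(2,4,9) card_all_ones_indices by simp
  have one: "outcome_prob n m p \<pi> 1 = (\<Sum>k\<in>\<K>. p (\<pi> k))"
    and zero: "outcome_prob n m p \<pi> 0 = (\<Sum>k\<in>{..<N} - \<K>. p (\<pi> k))" if "\<pi> \<in> sym_perms N" for \<pi>
    using outcome_prob_eq[where p = p and \<pi> = \<pi> and n = n] nonneg[OF that] assms(3,9) by auto
  have total: "outcome_prob n m p \<pi> 0 = 1 - outcome_prob n m p \<pi> 1" if "\<pi> \<in> sym_perms N" for \<pi>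
  proof -
    have perm: "\<pi> permutes {..<N}" using that by (simp add: sym_perms_def)
    \<comment> \<open>The two outcomes together sum \<open>p\<close> over all indices; permuting
      them leaves the total, which is \<open>A / A\<close>.\<close>
    have "(\<Sum>k\<in>{..<N} - \<K>. p (\<pi> k)) + (\<Sum>k\<in>\<K>. p (\<pi> k)) = (\<Sum>k<N. p (\<pi> k))"
      using sum.subset_diff[OF sub finite_lessThan] by metis
    also have "\<dots> = (\<Sum>k<N. p k)"
      using sum.permute[OF perm, of p] by (simp add: comp_def)
    also have "\<dots> = 1"
      using assms(6,7,8) by (simp flip: sum_divide_distrib)
    finally show ?thesis using one[OF that] zero[OF that] by simp
  qed
  have mean: "(\<Sum>k\<in>\<K>. a (\<pi> k)) = outcome_prob n m p \<pi> 1 * A" if "\<pi> \<in> sym_perms N" for \<pi>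
  proof -
    have "p (\<pi> k) * A = a (\<pi> k)" if "k \<in> \<K>" for k
      using that sub \<open>\<pi> \<in> sym_perms N\<close> permutes_in_image[of \<pi> "{..<N}" k] assms(7,8)
      by (auto simp: sym_perms_def)
    then show ?thesis unfolding one[OF that] by (simp add: sum_distrib_right)
  qed
  have "outcome_prob n m p \<pi> 1 = outcome_prob n m p \<tau> 1" if "(\<pi>, \<tau>) \<in> same_image_rel N \<K>" for \<pi> \<tau>
  proof -
    \<comment> \<open>Reindexing along the injective \<open>\<rho>\<close> leaves a sum that
      mentions \<open>\<rho>\<close> only through the image of \<open>\<K>\<close>.\<close>
    have "outcome_prob n m p \<rho> 1 = (\<Sum>x\<in>\<rho> ` \<K>. p x)" if "\<rho> \<in> sym_perms N" for \<rho>
      using one[OF that] that permutes_inj_on[of \<rho> _ \<K>]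
      by (auto simp: sum.reindex sym_perms_def)
    then show ?thesis using that by (auto simp: same_image_rel_def)
  qed
  then show ?thesis
    using one zero total mean card equiv_same_image_rel[of N \<K>]
      card_quotient_same_image_rel[OF sub] card_same_image_class_eq_fact[OF sub] by auto
qed

end
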